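(* Let $A=\{0,1,2,3\}$ and let $P_z,P_e$ be integers with $0\le P_z,P_e\le 9$. Let $K:A^{\mathbb{Z}^2}\to A^{\mathbb{Z}^2}$ be the language-shift cellular automaton with parameters $(P_z,P_e)$, and let $3^{\infty\times\infty}\in A^{\mathbb{Z}^2}$ be the configuration all of whose cells equal $3$. If $P_z>4$ or $P_e>4$, then the basin of attraction $B(3^{\infty\times\infty})=\{x\in A^{\mathbb{Z}^2}:\lim_{n\to+\infty}K^n(x)=3^{\infty\times\infty}\}$ does not contain any cylinder.
   Context: Let $A=\{0,1,2,3\}$ and let $P_z,P_e$ be integers with $0\le P_z\le 9$ and $0\le P_e\le 9$. For $x\in A^{\mathbb{Z}^2}$ and $(i,j)\in\mathbb{Z}^2$ put $$\Sigma_0(x)_{i,j}=\sum_{r=-1}^{1}\sum_{s=-1}^{1}\left\lfloor \frac{x_{(i+r,j+s)}}{2}\right\rfloor,\qquad \Sigma_1(x)_{i,j}=\sum_{r=-1}^{1}\sum_{s=-1}^{1}\left(x_{(i+r,j+s)}-2\left\lfloor \frac{x_{(i+r,j+s)}}{2}\right\rfloor\right).$$ (So $\Sigma_0$ counts the cells in state $2$ or $3$, and $\Sigma_1$ counts the cells in state $1$ or $3$, in the $3\times 3$ block centered at $(i,j)$, center included.) The language-shift cellular automaton $K$ with parameters $(P_z,P_e)$ is defined, at each $(i,j)\in\mathbb{Z}^2$, by: - if $x_{(i,j)}=0$: $K(x)_{(i,j)}=0$ if $\Sigma_0(x)_{i,j}<P_z$ and $\Sigma_1(x)_{i,j}<P_e$;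 $=1$ if $\Sigma_0(x)_{i,j}<P_z$ and $\Sigma_1(x)_{i,j}\ge P_e$; $=2$ if $\Sigma_0(x)_{i,j}\ge P_z$ and $\Sigma_1(x)_{i,j}<P_e$; $=3$ if $\Sigma_0(x)_{i,j}\ge P_z$ and $\Sigma_1(x)_{i,j}\ge P_e$; - if $x_{(i,j)}=1$: $K(x)_{(i,j)}=3$ if $\Sigma_0(x)_{i,j}\ge P_z$, and $=1$ otherwise; - if $x_{(i,j)}=2$: $K(x)_{(i,j)}=3$ if $\Sigma_1(x)_{i,j}\ge P_e$, and $=2$ otherwise; - if $x_{(i,j)}=3$: $K(x)_{(i,j)}=3$. Limits are taken in the product topology on $A^{\mathbb{Z}^2}$ ($A$ discrete), and $K^n$ is the $n$-fold iterate of $K$. A pattern $w\in A^{n\times m}$ ($n,m\ge 1$) has size $|w|=(|w|_1,|w|_2)=(n,m)$; a cylinder is a set of the form $[w]_{(i,j)}$ with $w$ a pattern and $(i,j)\in\mathbb{Z}^2$, where $[w]_{(i,j)}$ is the set of $x\in A^{\mathbb{Z}^2}$ whose restriction to $[i,i+|w|_1)\times[j,j+|w|_2)$ equals $w$. *)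

theory Defs
  imports "HOL-Analysis.Analysis"
begin

definition states :: "int set" where
  "states = {0, 1, 2, 3}"

definition configs :: "(int \<times> int \<Rightarrow> int) set" where
  "configs = (UNIV \<rightarrow>\<^sub>E states)"

definition Sigma0 :: "(int \<times> int \<Rightarrow> int) \<Rightarrow> int \<Rightarrow> int \<Rightarrow> int" where
  "Sigma0 x i j = (\<Sum>r = -1..1. \<Sum>s = -1..1. x (i + r, j + s) div 2)"

definition Sigma1 :: "(int \<times> int \<Rightarrow> int) \<Rightarrow> int \<Rightarrow> int \<Rightarrow> int" where
  "Sigma1 x i j =
     (\<Sum>r = -1..1. \<Sum>s = -1..1. x (i + r, j + s) - 2 * (x (i + r, j + s) div 2))"

(* Only the values on configs are meaningful; the last branch is the state 3. *)
definition language_shift ::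
  "int \<Rightarrow> int \<Rightarrow> (int \<times> int \<Rightarrow> int) \<Rightarrow> (int \<times> int \<Rightarrow> int)" where
  "language_shift Pz Pe x = (\<lambda>(i, j).
     if x (i, j) = 0 then
       (if Sigma0 x i j < Pz
        then (if Sigma1 x i j < Pe then 0 else 1)
        else (if Sigma1 x i j < Pe then 2 else 3))
     else if x (i, j) = 1 then (if Sigma0 x i j \<ge> Pz then 3 else 1)
     else if x (i, j) = 2 then (if Sigma1 x i j \<ge> Pe then 3 else 2)
     else 3)"

definition config_topology :: "(int \<times> int \<Rightarrow> int) topology" where
  "config_topology = product_topology (\<lambda>_. discrete_topology states) UNIV"

definition basin ::
  "((int \<times> int \<Rightarrow> int) \<Rightarrow> (int \<times> int \<Rightarrow> int)) \<Rightarrow> (int \<times> int \<Rightarrow> int)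
     \<Rightarrow> (int \<times> int \<Rightarrow> int) set" where
  "basin F y =
     {x \<in> configs. limitin config_topology (\<lambda>n. (F ^^ n) x) y sequentially}"

definition patterns :: "nat \<Rightarrow> nat \<Rightarrow> (nat \<times> nat \<Rightarrow> int) set" where
  "patterns n m = ({0..<n} \<times> {0..<m} \<rightarrow>\<^sub>E states)"

definition cylinder ::
  "nat \<Rightarrow> nat \<Rightarrow> (nat \<times> nat \<Rightarrow> int) \<Rightarrow> int \<Rightarrow> int \<Rightarrow> (int \<times> int \<Rightarrow> int) set" where
  "cylinder n m w i j =
     {x \<in> configs. \<forall>a<n. \<forall>b<m. x (i + int a, j + int b) = w (a, b)}"

definition is_cylinder :: "(int \<times> int \<Rightarrow> int) set \<Rightarrow> bool" where
  "is_cylinder C \<longleftrightarrow>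
     (\<exists>n m w i j. n \<ge> 1 \<and> m \<ge> 1 \<and> w \<in> patterns n m \<and> C = cylinder n m w i j)"

lemma topspace_config_topology: "topspace config_topology = configs"
  by (simp add: config_topology_def configs_def)

lemma language_shift_configs:
  "x \<in> configs \<Longrightarrow> language_shift Pz Pe x \<in> configs"
  by (auto simp: configs_def states_def language_shift_def)

end

theory Submission
  imports Defs
begin

text \<open>
  The automaton runs two independent monotone threshold growth rules, one on the high bit
  \<^term>\<open>a div 2\<close> and one on the low bit \<^term>\<open>a mod 2\<close> of the states. If a bit vanishes on
  a half-plane, then every cell of the half-plane has at most three set bits in its block, so with a
  threshold above 3 the bit stays zero there forever and the state 3 never appears. Every
  cylinder contains a configuration that is zero on a half-plane.
\<close>

text \<open>Both \<open>p - 1\<close> and \<open>p\<close> lie below \<open>k\<close>, so only the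
  three cells with first coordinate \<open>p + 1\<close> can contribute, each at most 1.\<close>

lemma block_sum_half_plane_le:
  fixes f :: "int \<times> int \<Rightarrow> int"
  assumes le: "\<And>c. f c \<le> 1" and zero: "\<And>p q. p < k \<Longrightarrow> f (p, q) = 0" and "p < k"
  shows "(\<Sum>r = -1..1. \<Sum>s = -1..1. f (p + r, q + s)) \<le> 3"
proof -
  have "{-1..1::int} = {-1, 0, 1}"
    by auto
  moreover have "f (p - 1, q') = 0" "f (p, q') = 0" for q'
    using zero \<open>p < k\<close> by auto
  ultimately show ?thesis
    using le[of "(p + 1, q - 1)"] le[of "(p + 1, q)"] le[of "(p + 1, q + 1)"] by simp
qed

lemma configs_cases:
  assumes "x \<in> configs"
  obtains "x c = 0" | "x c = 1" | "x c = 2" | "x c = 3"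
  using assms by (cases c) (auto simp: configs_def states_def PiE_iff)

text \<open>A zero high bit turns on only when \<open>Sigma0\<close> reaches \<open>Pz\<close>,
  which the bound 3 on the block sum prevents. The low bit is left free.\<close>

lemma language_shift_high_bit_half_plane:
  assumes x: "x \<in> configs" and "3 < Pz" and zero: "\<And>p q. p < k \<Longrightarrow> x (p, q) div 2 = 0" and "p < k"
  shows "language_shift Pz Pe x (p, q) div 2 = 0"
proof -
  have "x c div 2 \<le> 1" for c
    by (rule configs_cases[OF x, of c]) auto
  then have "Sigma0 x p q \<le> 3"
    unfolding Sigma0_def
    using block_sum_half_plane_le[of "\<lambda>c. x c div 2" k p q] zero \<open>p < k\<close> by simp
  then show ?thesis
    using zero[OF \<open>p < k\<close>, of q] \<open>3 < Pz\<close>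
    by (cases rule: configs_cases[OF x, of "(p, q)"]) (auto simp: language_shift_def)
qed

lemma language_shift_low_bit_half_plane:
  assumes x: "x \<in> configs" and "3 < Pe" and zero: "\<And>p q. p < k \<Longrightarrow> x (p, q) mod 2 = 0" and "p < k"
  shows "language_shift Pz Pe x (p, q) mod 2 = 0"
proof -
  have "Sigma1 x p q \<le> 3"
    unfolding Sigma1_def minus_mult_div_eq_mod
    using block_sum_half_plane_le[of "\<lambda>c. x c mod 2" k p q] zero \<open>p < k\<close> by simp
  then show ?thesis
    using zero[OF \<open>p < k\<close>, of q] \<open>3 < Pe\<close>
    by (cases rule: configs_cases[OF x, of "(p, q)"]) (auto simp: language_shift_def)
qed

lemma language_shift_funpow_configs:
  "x \<in> configs \<Longrightarrow> (language_shift Pz Pe ^^ n) x \<in> configs"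
  by (induction n) (auto intro: language_shift_configs)

text \<open>State 3 has both bits set, so one bit frozen at zero is enough to exclude it.\<close>

lemma language_shift_funpow_half_plane_neq_3:
  assumes x: "x \<in> configs" and "3 < Pz \<or> 3 < Pe"
    and zero: "\<And>p q. p < k \<Longrightarrow> x (p, q) = 0" and "p < k"
  shows "(language_shift Pz Pe ^^ n) x (p, q) \<noteq> 3"
proof -
  let ?y = "\<lambda>n. (language_shift Pz Pe ^^ n) x"
  \<comment> \<open>The induction generalizes over the cell because one step at a cell needs the bit
    to vanish on the whole half-plane.\<close>
  have "?y n (p, q) div 2 = 0" if "3 < Pz"
    using \<open>p < k\<close>
    by (induction n arbitrary: p q)
       (auto simp: zero intro!: language_shift_high_bit_half_plane[where k = k]
          language_shift_funpow_configs x that)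
  moreover have "?y n (p, q) mod 2 = 0" if "3 < Pe"
    using \<open>p < k\<close>
    by (induction n arbitrary: p q)
       (auto simp: zero intro!: language_shift_low_bit_half_plane[where k = k]
          language_shift_funpow_configs x that simp del: even_iff_mod_2_eq_zero)
  ultimately show ?thesis
    using \<open>3 < Pz \<or> 3 < Pe\<close> by auto
qed

text \<open>Projection to the cell \<open>c\<close> is continuous, and in the discrete topology the
  singleton of the limit value is an open neighbourhood.\<close>

lemma basin_eventually_eq:
  assumes "x \<in> basin F y"
  shows "\<forall>\<^sub>F n in sequentially. (F ^^ n) x c = y c"
proof -
  have "limitin config_topology (\<lambda>n. (F ^^ n) x) y sequentially"
    using assms by (simp add: basin_def)
  moreover have "continuous_map config_topology (discrete_topology states) (\<lambda>z. z c)"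
    unfolding config_topology_def by (rule continuous_map_product_projection) simp
  ultimately have "limitin (discrete_topology states) (\<lambda>n. (F ^^ n) x c) (y c) sequentially"
    using continuous_map_limit by (fastforce simp: o_def)
  then have "\<forall>U. openin (discrete_topology states) U \<and> y c \<in> U \<longrightarrow>
      (\<forall>\<^sub>F n in sequentially. (F ^^ n) x c \<in> U)" "y c \<in> states"
    by (simp_all add: limitin_def)
  from this(1)[rule_format, of "{y c}"] this(2) show ?thesis
    by simp
qed

lemma cylinder_half_plane_zero:
  assumes "w \<in> patterns n m"
  obtains x where "x \<in> cylinder n m w i j" and "\<And>p q. p < i \<Longrightarrow> x (p, q) = 0"
proof
  \<comment> \<open>The pattern is padded with zeros outside its window, in particular wherever
    \<open>p < i\<close>.\<close>
  let ?x = "\<lambda>(p, q). if i \<le> p \<and> p < i + int n \<and> j \<le> q \<and> q < j + int m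
    then w (nat (p - i), nat (q - j)) else 0"
  have "w (a, b) \<in> states" if "a < n" "b < m" for a b
    using assms that by (auto simp: patterns_def PiE_iff)
  moreover have "0 \<in> states"
    by (simp add: states_def)
  ultimately have "?x \<in> configs"
    by (auto simp: configs_def)
  then show "?x \<in> cylinder n m w i j"
    by (auto simp: cylinder_def)
  show "?x (p, q) = 0" if "p < i" for p q
    using that by simp
qed

theorem proposition10:
  fixes Pz Pe :: int
  assumes "0 \<le> Pz" "Pz \<le> 9" "0 \<le> Pe" "Pe \<le> 9"
    and "Pz > 4 \<or> Pe > 4"
  shows "\<not> (\<exists>C. is_cylinder C \<and> C \<subseteq> basin (language_shift Pz Pe) (\<lambda>_. 3))"
proof
  assume "\<exists>C. is_cylinder C \<and> C \<subseteq> basin (language_shift Pz Pe) (\<lambda>_. 3)"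
  then obtain n m w i j where w: "w \<in> patterns n m"
    and sub: "cylinder n m w i j \<subseteq> basin (language_shift Pz Pe) (\<lambda>_. 3)"
    by (auto simp: is_cylinder_def)
  obtain x where x: "x \<in> cylinder n m w i j" and zero: "\<And>p q. p < i \<Longrightarrow> x (p, q) = 0"
    using cylinder_half_plane_zero[OF w] by blast
  \<comment> \<open>The cell \<open>(i - 1, j)\<close> is adjacent to the window and lies in the
    zero half-plane, yet membership in the basin would force it to become 3.\<close>
  have "\<forall>\<^sub>F t in sequentially. (language_shift Pz Pe ^^ t) x (i - 1, j) = 3"
    using basin_eventually_eq sub x by blast
  then obtain t where "(language_shift Pz Pe ^^ t) x (i - 1, j) = 3"
    by (auto simp: eventually_sequentially)
  moreover have "x \<in> configs"
    using x by (simp add: cylinder_def)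
  ultimately show False
    using language_shift_funpow_half_plane_neq_3[of x Pz Pe i "i - 1" t j] zero assms(5) by auto
qed

end
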